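(* Let $G=(V,E)$ be a directed acyclic graph with vertices $1,\dots,n$ listed in a topological order in which every vertex appears after all of its children, let $\mathbf{a}\in\mathbb{R}^n_{\ge0}$ and let $t\ge 0$. Define $\mathbf{x}^{min}$ recursively for $i=1,\dots,n$ by $x^{min}_i=\max\{0,\ \sum_{j\in C(i)}x^{min}_j,\ a_i-t\}$. Then $\mathbf{x}=\mathbf{x}^{min}$ is a valid solution. Furthermore, if $\|\mathbf{x}-\mathbf{a}\|_\infty>t$, then there does not exist a valid solution $\mathbf{x}'$ with $\|\mathbf{a}-\mathbf{x}'\|_\infty\le t$.
   Context: For a vertex $i$ of the DAG, $C(i)$ (the children of $i$) is the set of vertices $j$ with an edge $(j,i)\in E$. A vector $\mathbf{x}\in\mathbb{R}^n$ is a valid solution if $x_i\ge0$ for all $i$ and $x_i\ge\sum_{j\in C(i)}x_j$ for every vertex $i$. *)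

theory Defs
  imports Complex_Main
begin

text \<open>
  Edges are pairs \<open>(j, i)\<close> with \<open>j\<close> a child of \<open>i\<close>. The vertex numbers \<open>1..n\<close> are the
  positions in the topological order. Vectors in \<open>\<real>\<^sup>n\<close> are functions of type
  \<^typ>\<open>nat \<Rightarrow> real\<close>; only their values on \<open>{1..n}\<close> matter.
\<close>

definition children :: "(nat \<times> nat) set \<Rightarrow> nat \<Rightarrow> nat set" where
  "children E i = {j. (j, i) \<in> E}"

definition valid_solution :: "nat \<Rightarrow> (nat \<times> nat) set \<Rightarrow> (nat \<Rightarrow> real) \<Rightarrow> bool" where
  "valid_solution n E x \<longleftrightarrow>
     (\<forall>i\<in>{1..n}. x i \<ge> 0) \<and> (\<forall>i\<in>{1..n}. x i \<ge> (\<Sum>j\<in>children E i. x j))"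

text \<open>The inserted \<open>0\<close> only matters for \<open>n = 0\<close>, where \<^const>\<open>Max\<close> would be unspecified.\<close>

definition sup_norm :: "nat \<Rightarrow> (nat \<Rightarrow> real) \<Rightarrow> real" where
  "sup_norm n x = Max (insert 0 ((\<lambda>i. \<bar>x i\<bar>) ` {1..n}))"

locale topologically_ordered_dag =
  fixes n :: nat and E :: "(nat \<times> nat) set"
  assumes edges: "E \<subseteq> {1..n} \<times> {1..n}"
    and acyclic: "acyclic E"
    and topological: "(j, i) \<in> E \<Longrightarrow> j < i"
begin

text \<open>Defined inside the locale because termination needs the assumption \<open>topological\<close>.\<close>

function x_min :: "(nat \<Rightarrow> real) \<Rightarrow> real \<Rightarrow> nat \<Rightarrow> real" where
  "x_min a t i = Max {0, \<Sum>j\<in>children E i. x_min a t j, a i - t}"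
  by pat_completeness auto
termination
  by (relation "measure (\<lambda>(a, t, i). i)") (auto simp: children_def topological)

declare x_min.simps [simp del]

end

end

theory Submission
  imports Defs
begin

text \<open>
  The vector \<open>x_min\<close> is the least valid solution lying above \<open>a - t\<close>. Hence every valid
  solution \<open>x'\<close> within distance \<open>t\<close> of \<open>a\<close> yields \<open>a - t \<le> x_min \<le> x' \<le> a + t\<close>.
\<close>

text \<open>The hypothesis on \<open>t\<close> takes care of the \<open>0\<close> inserted into the
  maximum.\<close>

lemma sup_norm_le_iff:
  assumes "t \<ge> 0"
  shows "sup_norm n x \<le> t \<longleftrightarrow> (\<forall>i\<in>{1..n}. \<bar>x i\<bar> \<le> t)"
  using assms unfolding sup_norm_def by (subst Max_le_iff) auto

context topologically_ordered_dag
begin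

text \<open>The recursion takes a maximum of three terms, so its upper bounds are their common upper
  bounds. Taking \<open>c\<close> to be \<open>x_min a t i\<close> itself gives validity and the
  bound by \<open>a i - t\<close>; taking a competitor's value gives minimality.\<close>

lemma x_min_le_iff:
  "x_min a t i \<le> c \<longleftrightarrow> 0 \<le> c \<and> (\<Sum>j\<in>children E i. x_min a t j) \<le> c \<and> a i - t \<le> c"
  by (subst x_min.simps) simp

lemma valid_solution_x_min: "valid_solution n E (x_min a t)"
  using x_min_le_iff[of a t _ "x_min a t _"] unfolding valid_solution_def by blast

lemma x_min_ge: "a i - t \<le> x_min a t i"
  using x_min_le_iff[of a t i "x_min a t i"] by blast

text \<open>Strong induction along the topological order: the bounds at the children add up, and
  validity of \<open>y\<close> bounds their total by \<open>y i\<close>.\<close>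

lemma x_min_least:
  assumes valid: "valid_solution n E y"
    and ge: "\<And>i. i \<in> {1..n} \<Longrightarrow> a i - t \<le> y i"
    and "i \<in> {1..n}"
  shows "x_min a t i \<le> y i"
  using \<open>i \<in> {1..n}\<close>
proof (induction i rule: less_induct)
  case (less i)
  \<comment> \<open>The induction hypothesis applies to each child: \<open>topological\<close> makes
    it smaller than \<open>i\<close>, and \<open>edges\<close> keeps it in
    \<open>{1..n}\<close>.\<close>
  have "(\<Sum>j\<in>children E i. x_min a t j) \<le> (\<Sum>j\<in>children E i. y j)"
    using less.IH edges topological by (intro sum_mono) (auto simp: children_def)
  then show ?case
    using valid ge[OF less.prems] less.prems
    unfolding x_min_le_iff valid_solution_def by fastforce
qed

end

theorem theorem5:
  fixes n :: nat and E :: "(nat \<times> nat) set" and a x :: "nat \<Rightarrow> real" and t :: real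
  assumes "topologically_ordered_dag n E"
    and "\<forall>i\<in>{1..n}. a i \<ge> 0"
    and "t \<ge> 0"
    and "x = topologically_ordered_dag.x_min E a t"
  shows "valid_solution n E x \<and>
    (sup_norm n (\<lambda>i. x i - a i) > t \<longrightarrow>
      \<not> (\<exists>x'. valid_solution n E x' \<and> sup_norm n (\<lambda>i. a i - x' i) \<le> t))"
proof -
  interpret topologically_ordered_dag n E by fact
  \<comment> \<open>This is the contrapositive of the second claim.\<close>
  have "sup_norm n (\<lambda>i. x i - a i) \<le> t"
    if valid: "valid_solution n E x'" and close: "sup_norm n (\<lambda>i. a i - x' i) \<le> t" for x'
  proof -
    have dist: "\<bar>a i - x' i\<bar> \<le> t" if "i \<in> {1..n}" for i
      using close that by (simp add: sup_norm_le_iff[OF \<open>t \<ge> 0\<close>])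
    have "\<bar>x i - a i\<bar> \<le> t" if "i \<in> {1..n}" for i
    proof -
      have "x i \<le> x' i"
        unfolding assms(4) using valid _ that
      proof (rule x_min_least)
        show "a i - t \<le> x' i" if "i \<in> {1..n}" for i
          using dist[OF that] by linarith
      qed
      moreover have "a i - t \<le> x i"
        unfolding assms(4) by (rule x_min_ge)
      ultimately show ?thesis
        using dist[OF that] by linarith
    qed
    then show ?thesis
      by (simp add: sup_norm_le_iff[OF \<open>t \<ge> 0\<close>])
  qed
  then show ?thesis
    using valid_solution_x_min assms(4) by fastforce
qed

end
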